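(* Every connected interval graph has a multi-chain ordering.
   Context: An interval graph is a simple graph whose vertices can be identified with real intervals so that two vertices are adjacent iff their intervals intersect. A chain graph is a bipartite graph (with given sides) containing no induced $2K_2$. For a connected graph $G$ and vertex $v_0$, the distance layers are $L_0=\{v_0\},L_1,\dots,L_z$ with $L_i$ the set of vertices at distance $i$ from $v_0$ and $z$ maximal with $L_z\ne\emptyset$. They form a multi-chain ordering if for each $0\le i<z$ the bipartite graph with sides $L_i,L_{i+1}$ and the edges of $G$ between them is a chain graph. A connected graph has a multi-chain ordering if such $v_0$ exists. *)

theory Defs
  imports "HOL-Analysis.Analysis" "Graph_Theory.Graph_Theory"
begin

text \<open>
  Finite simple graphs are represented by the locale \<^locale>\<open>graph\<close>: finite digraphs without loops
  and without parallel arcs whose arc relation \<^const>\<open>arcs_ends\<close> is symmetric.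
  Vertices are adjacent iff \<^const>\<open>dominates\<close> holds between them.
  The name \<open>connected\<close> is qualified because it also denotes topological connectedness.
\<close>

text \<open>
  Intervals may be open, closed, half-open or unbounded, but not empty.
  Different vertices may be represented by the same interval.
\<close>
definition interval_graph :: "('a, 'b) pre_digraph \<Rightarrow> bool" where
  "interval_graph G \<longleftrightarrow> graph G \<and>
     (\<exists>I :: 'a \<Rightarrow> real set.
        (\<forall>v\<in>verts G. is_interval (I v) \<and> I v \<noteq> {}) \<and>
        (\<forall>u\<in>verts G. \<forall>v\<in>verts G. u \<noteq> v \<longrightarrow> (u \<rightarrow>\<^bsub>G\<^esub> v \<longleftrightarrow> I u \<inter> I v \<noteq> {})))"

definition bipartite_with_sides :: "('a, 'b) pre_digraph \<Rightarrow> 'a set \<Rightarrow> 'a set \<Rightarrow> bool" where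
  "bipartite_with_sides G A B \<longleftrightarrow>
     graph G \<and> verts G = A \<union> B \<and> A \<inter> B = {} \<and> arcs_ends G \<subseteq> A \<times> B \<union> B \<times> A"

text \<open>The graph \<open>2K\<^sub>2\<close>: four vertices and two disjoint edges.\<close>
definition two_K2 :: "('a, 'b) pre_digraph \<Rightarrow> bool" where
  "two_K2 K \<longleftrightarrow> graph K \<and>
     (\<exists>a b c d. distinct [a, b, c, d] \<and> verts K = {a, b, c, d} \<and>
        arcs_ends K = {(a, b), (b, a), (c, d), (d, c)})"

definition chain_graph :: "('a, 'b) pre_digraph \<Rightarrow> 'a set \<Rightarrow> 'a set \<Rightarrow> bool" where
  "chain_graph G A B \<longleftrightarrow>
     bipartite_with_sides G A B \<and> \<not> (\<exists>K. induced_subgraph K G \<and> two_K2 K)"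

definition bipartite_between :: "('a, 'b) pre_digraph \<Rightarrow> 'a set \<Rightarrow> 'a set \<Rightarrow> ('a, 'b) pre_digraph" where
  "bipartite_between G A B =
     \<lparr> verts = A \<union> B,
       arcs = {e \<in> arcs G. tail G e \<in> A \<and> head G e \<in> B \<or> tail G e \<in> B \<and> head G e \<in> A},
       tail = tail G, head = head G \<rparr>"

text \<open>
  With all arc weights equal to 1, \<^const>\<open>wf_digraph.\<mu>\<close> is the usual graph distance
  (as an extended real, infinite between different components).
\<close>
definition distance_layer :: "('a, 'b) pre_digraph \<Rightarrow> 'a \<Rightarrow> nat \<Rightarrow> 'a set" where
  "distance_layer G v\<^sub>0 i = {v \<in> verts G. wf_digraph.\<mu> G (\<lambda>_. 1) v\<^sub>0 v = ereal (real i)}"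

definition last_layer :: "('a, 'b) pre_digraph \<Rightarrow> 'a \<Rightarrow> nat" where
  "last_layer G v\<^sub>0 = Max {i. distance_layer G v\<^sub>0 i \<noteq> {}}"

definition multi_chain_ordering_from :: "('a, 'b) pre_digraph \<Rightarrow> 'a \<Rightarrow> bool" where
  "multi_chain_ordering_from G v\<^sub>0 \<longleftrightarrow>
     (\<forall>i < last_layer G v\<^sub>0.
        chain_graph
          (bipartite_between G (distance_layer G v\<^sub>0 i) (distance_layer G v\<^sub>0 (i + 1)))
          (distance_layer G v\<^sub>0 i) (distance_layer G v\<^sub>0 (i + 1)))"

definition has_multi_chain_ordering :: "('a, 'b) pre_digraph \<Rightarrow> bool" where
  "has_multi_chain_ordering G \<longleftrightarrow> (\<exists>v\<^sub>0\<in>verts G. multi_chain_ordering_from G v\<^sub>0)"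

end

theory Submission
  imports Defs
begin

text \<open>
  Start from a vertex \<open>v\<^sub>0\<close> whose interval has no other interval completely to its left. By induction on
  the distance, every vertex whose distance from \<open>v\<^sub>0\<close> exceeds that of \<open>w\<close> by at least two lies
  completely to the right of \<open>w\<close>. Suppose that the edges \<open>ac\<close> and \<open>bd\<close> form an induced
  \<open>2K\<^sub>2\<close> between consecutive layers, with \<open>a\<close> and \<open>b\<close> in the layer closer to \<open>v\<^sub>0\<close>, and let
  \<open>x \<in> I a \<inter> I c\<close>, \<open>y \<in> I b \<inter> I d\<close>, where \<open>x \<le> y\<close> without loss of generality. The interval of \<open>b\<close> meets
  that of a vertex in the layer before, hence contains a point to the left of \<open>x\<close>; as it
  also contains \<open>y\<close>, it contains \<open>x\<close>, and \<open>b\<close> is adjacent to \<open>c\<close>, a contradiction.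
\<close>

subsection \<open>Distance layers\<close>

lemma arcs_ends_bipartite_between:
  "arcs_ends (bipartite_between G A B) = arcs_ends G \<inter> (A \<times> B \<union> B \<times> A)"
  by (auto simp: bipartite_between_def arcs_ends_def arc_to_ends_def)

context fin_digraph
begin

lemma awalk_cost_unit: "awalk_cost (\<lambda>_. 1) p = real (length p)"
  by (induction p) auto

text \<open>A finite distance is attained by a path, and with unit weights a path of cost 0 is
  empty.\<close>

lemma distance_layer_0D:
  assumes "v \<in> distance_layer G v\<^sub>0 0"
  shows "v = v\<^sub>0"
proof -
  have "\<mu> (\<lambda>_. 1) v\<^sub>0 v = 0" using assms by (simp add: distance_layer_def zero_ereal_def)
  then obtain p where "apath v\<^sub>0 p v" "awalk_cost (\<lambda>_. 1) p = 0"
    using min_cost_awalk[of v\<^sub>0 v "\<lambda>_. 1"] \<mu>_reach_conv[of "\<lambda>_. 1" v\<^sub>0 v] by (force simp: zero_ereal_def)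
  then show ?thesis by (simp add: awalk_cost_unit apath_Nil_iff)
qed

lemma distance_layer_arc_le:
  assumes "u \<in> distance_layer G v\<^sub>0 i" "v \<in> distance_layer G v\<^sub>0 j" "u \<rightarrow>\<^bsub>G\<^esub> v"
  shows "j \<le> Suc i"
proof -
  obtain e where "arc_to_ends G e = (u, v)" "e \<in> arcs G"
    using assms(3) by (auto simp: arcs_ends_def)
  then have "\<mu> (\<lambda>_. 1) v\<^sub>0 v \<le> \<mu> (\<lambda>_. 1) v\<^sub>0 u + ereal 1"
    using pos_cost_mu_triangle[of "\<lambda>_. 1"] by simp
  then show ?thesis using assms(1,2) by (simp add: distance_layer_def)
qed

text \<open>The vertex sought is the last but one on a shortest walk to \<open>v\<close>: the
  shortened walk bounds its distance from above, the triangle inequality along the last arc from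
  below.\<close>

lemma distance_layer_SucE:
  assumes "v \<in> distance_layer G v\<^sub>0 (Suc i)"
  obtains u where "u \<in> distance_layer G v\<^sub>0 i" "u \<rightarrow>\<^bsub>G\<^esub> v"
proof -
  have mu: "\<mu> (\<lambda>_. 1) v\<^sub>0 v = ereal (real (Suc i))"
    using assms by (simp add: distance_layer_def)
  then obtain p where p: "awalk v\<^sub>0 p v" "length p = Suc i"
    using min_cost_awalk[of v\<^sub>0 v "\<lambda>_. 1"] \<mu>_reach_conv[of "\<lambda>_. 1" v\<^sub>0 v]
    by (auto simp: awalk_cost_unit apath_def)
  then obtain q e where "p = q @ [e]" by (cases p rule: rev_cases) auto
  then have q: "awalk v\<^sub>0 q (tail G e)" and e: "e \<in> arcs G" "head G e = v" and "length q = i"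
    using p by (auto simp: awalk_simps)
  have "\<mu> (\<lambda>_. 1) v\<^sub>0 (tail G e) \<le> ereal (real i)"
    using min_cost_le_walk_cost[OF q, of "\<lambda>_. 1"] \<open>length q = i\<close> by (simp add: awalk_cost_unit)
  moreover have "\<mu> (\<lambda>_. 1) v\<^sub>0 v \<le> \<mu> (\<lambda>_. 1) v\<^sub>0 (tail G e) + ereal 1"
    using pos_cost_mu_triangle[of "\<lambda>_. 1" e] e by (simp add: arc_to_ends_def)
  ultimately have "\<mu> (\<lambda>_. 1) v\<^sub>0 (tail G e) = ereal (real i)"
    \<comment> \<open>Distances are extended reals; the two bounds exclude both infinite
      values.\<close>
    using mu by (cases "\<mu> (\<lambda>_. 1) v\<^sub>0 (tail G e)") auto
  moreover have "tail G e \<rightarrow>\<^bsub>G\<^esub> v" using e by (auto intro: in_arcs_imp_in_arcs_ends)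
  ultimately show thesis
    using that[of "tail G e"] e by (auto simp: distance_layer_def)
qed

end

lemma distance_layer_subset_verts: "distance_layer G v\<^sub>0 i \<subseteq> verts G"
  by (auto simp: distance_layer_def)

lemma distance_layer_disjoint: "i \<noteq> j \<Longrightarrow> distance_layer G v\<^sub>0 i \<inter> distance_layer G v\<^sub>0 j = {}"
  by (auto simp: distance_layer_def)

subsection \<open>Chain graphs between vertex sets\<close>

lemma bipartite_with_sides_bipartite_between:
  assumes "graph G" "A \<subseteq> verts G" "B \<subseteq> verts G" "A \<inter> B = {}"
  shows "bipartite_with_sides (bipartite_between G A B) A B"
proof -
  interpret graph G by fact
  let ?H = "bipartite_between G A B"
  have "digraph ?H"
    using assms(2-4) finite_subset[OF assms(2)] finite_subset[OF assms(3)]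
    by unfold_locales
      (auto simp: bipartite_between_def arc_to_ends_def intro: no_multi_arcs)
  moreover have "symmetric ?H"
    using sym_arcs by (auto simp: symmetric_def sym_def arcs_ends_bipartite_between)
  ultimately have "graph ?H" by (rule digraph.graphI)
  then show ?thesis
    using assms(4) by (auto simp: bipartite_with_sides_def arcs_ends_bipartite_between)
      (auto simp: bipartite_between_def)
qed

text \<open>Replaces the quantification over induced subgraphs by a condition on four vertices, in
  which the two edges are already directed from \<open>A\<close> to \<open>B\<close>.\<close>

lemma chain_graph_bipartite_betweenI:
  assumes "graph G" "A \<subseteq> verts G" "B \<subseteq> verts G" "A \<inter> B = {}"
    and no_2K2: "\<And>a b c d. \<lbrakk>a \<in> A; b \<in> A; c \<in> B; d \<in> B; a \<noteq> b; a \<rightarrow>\<^bsub>G\<^esub> c; b \<rightarrow>\<^bsub>G\<^esub> d\<rbrakk>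
      \<Longrightarrow> a \<rightarrow>\<^bsub>G\<^esub> d \<or> b \<rightarrow>\<^bsub>G\<^esub> c"
  shows "chain_graph (bipartite_between G A B) A B"
proof -
  let ?H = "bipartite_between G A B"
  have False if K: "induced_subgraph K ?H" "two_K2 K" for K
  proof -
    obtain a b c d where dist: "distinct [a, b, c, d]" and V: "verts K = {a, b, c, d}"
      and E: "arcs_ends K = {(a, b), (b, a), (c, d), (d, c)}"
      using K(2) by (auto simp: two_K2_def)
    have sub: "compatible ?H K" "arcs K = {e \<in> arcs ?H. tail ?H e \<in> verts K \<and> head ?H e \<in> verts K}"
      using K(1) by (auto simp: induced_subgraph_def subgraph_def)
    then have KH: "arcs_ends K = arcs_ends ?H \<inter> verts K \<times> verts K"
      by (auto simp: arcs_ends_conv compatible_def)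
    have sides: "u \<in> A \<and> v \<in> B \<or> u \<in> B \<and> v \<in> A" "u \<rightarrow>\<^bsub>G\<^esub> v"
      if "(u, v) \<in> arcs_ends K" for u v
      using that by (auto simp: KH arcs_ends_bipartite_between)
    have non: "\<not> u \<rightarrow>\<^bsub>G\<^esub> v"
      if "u \<in> A" "v \<in> B" "u \<in> verts K" "v \<in> verts K" "(u, v) \<notin> arcs_ends K" for u v
      using that by (auto simp: KH arcs_ends_bipartite_between)
    \<comment> \<open>Every edge of \<open>K\<close> crosses between the sides, so its ends can be
      renamed to put \<open>a'\<close> and \<open>c'\<close> in \<open>A\<close>, \<open>b'\<close>
      and \<open>d'\<close> in \<open>B\<close>.\<close>
    obtain a' b' where 1: "a' \<in> A" "b' \<in> B" "(a', b') \<in> arcs_ends K" "{a', b'} = {a, b}"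
      using sides[of a b] E by auto
    obtain c' d' where 2: "c' \<in> A" "d' \<in> B" "(c', d') \<in> arcs_ends K" "{c', d'} = {c, d}"
      using sides[of c d] E by auto
    have "a' \<noteq> c'" "(a', d') \<notin> arcs_ends K" "(c', b') \<notin> arcs_ends K"
      "a' \<in> verts K" "b' \<in> verts K" "c' \<in> verts K" "d' \<in> verts K"
      using 1(4) 2(4) dist E V by (auto simp: doubleton_eq_iff)
    then show False
      using no_2K2[of a' c' b' d'] non[of a' d'] non[of c' b'] sides(2) 1 2 by auto
  qed
  then show ?thesis
    using bipartite_with_sides_bipartite_between[OF assms(1-4)] by (auto simp: chain_graph_def)
qed

subsection \<open>Interval representations\<close>

text \<open>An empty set would be related to every set in both directions; asymmetry and
  transitivity therefore ask for nonempty sets.\<close>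

definition left_of :: "real set \<Rightarrow> real set \<Rightarrow> bool" where
  "left_of X Y \<longleftrightarrow> (\<forall>x\<in>X. \<forall>y\<in>Y. x < y)"

lemma left_of_asym:
  assumes "left_of X Y" "X \<noteq> {}" "Y \<noteq> {}"
  shows "\<not> left_of Y X"
proof -
  obtain x y where "x \<in> X" "y \<in> Y" using assms by blast
  then show ?thesis using assms(1) unfolding left_of_def by (metis less_asym)
qed

lemma left_of_trans:
  assumes "left_of X Y" "left_of Y Z" "Y \<noteq> {}"
  shows "left_of X Z"
  unfolding left_of_def
proof (intro ballI)
  fix x z
  assume "x \<in> X" "z \<in> Z"
  moreover obtain y where "y \<in> Y" using assms by blast
  ultimately have "x < y" "y < z" using assms by (auto simp: left_of_def)
  then show "x < z" by simp
qed

text \<open>One pair of points decides the order of two disjoint intervals: any pair in the wrong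
  order would, by convexity, force a common point.\<close>

lemma left_of_if_disjoint:
  assumes "is_interval X" "is_interval Y" "X \<inter> Y = {}" "x \<in> X" "y \<in> Y" "x < y"
  shows "left_of X Y"
proof -
  have right: "x' < y" if "x' \<in> X" for x'
  proof (rule ccontr)
    assume "\<not> x' < y"
    then have "y \<in> X" using mem_is_interval_1_I[OF assms(1,4) that, of y] assms(6) by simp
    then show False using assms(3,5) by blast
  qed
  show ?thesis
    unfolding left_of_def
  proof (intro ballI, rule ccontr)
    fix x' y'
    assume *: "x' \<in> X" "y' \<in> Y" "\<not> x' < y'"
    \<comment> \<open>Here \<open>y' \<le> x' < y\<close> with both ends in
      \<open>Y\<close>.\<close>
    then have "x' \<in> Y" using mem_is_interval_1_I[OF assms(2) *(2) assms(5), of x'] right[of x'] by simp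
    then show False using assms(3) \<open>x' \<in> X\<close> by blast
  qed
qed

locale interval_representation = graph G for G :: "('a, 'b) pre_digraph" +
  fixes I :: "'a \<Rightarrow> real set"
  assumes interval: "v \<in> verts G \<Longrightarrow> is_interval (I v)"
    and nonempty: "v \<in> verts G \<Longrightarrow> I v \<noteq> {}"
    and adj_iff: "\<lbrakk>u \<in> verts G; v \<in> verts G; u \<noteq> v\<rbrakk> \<Longrightarrow> u \<rightarrow>\<^bsub>G\<^esub> v \<longleftrightarrow> I u \<inter> I v \<noteq> {}"
begin

lemma arc_inter: "u \<rightarrow>\<^bsub>G\<^esub> v \<Longrightarrow> I u \<inter> I v \<noteq> {}"
  using adj_iff[of u v] adj_not_same adj_in_verts by blast

text \<open>On nonempty sets \<open>left_of\<close> is a strict partial order, so the finite vertex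
  set has a minimal element.\<close>

lemma ex_leftmost:
  assumes "verts G \<noteq> {}"
  obtains v\<^sub>0 where "v\<^sub>0 \<in> verts G" "\<And>v. v \<in> verts G \<Longrightarrow> \<not> left_of (I v) (I v\<^sub>0)"
proof -
  have "asymp_on (verts G) (\<lambda>u v. left_of (I u) (I v))"
    using nonempty left_of_asym by (auto intro: asymp_onI)
  moreover have "transp_on (verts G) (\<lambda>u v. left_of (I u) (I v))"
    using nonempty left_of_trans by (auto intro: transp_onI)
  ultimately obtain m where "m \<in> verts G" "\<And>v. \<lbrakk>v \<in> verts G; v \<noteq> m\<rbrakk> \<Longrightarrow> \<not> left_of (I v) (I m)"
    using Finite_Set.bex_min_element[OF finite_verts _ _ assms, of "\<lambda>u v. left_of (I u) (I v)"]
    by blast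
  then show thesis using that left_of_asym nonempty by blast
qed

context
  fixes v\<^sub>0
  assumes v\<^sub>0: "v\<^sub>0 \<in> verts G" and leftmost: "\<And>v. v \<in> verts G \<Longrightarrow> \<not> left_of (I v) (I v\<^sub>0)"
begin

lemma left_of_later_layer:
  assumes "v \<in> distance_layer G v\<^sub>0 j" "c \<in> distance_layer G v\<^sub>0 k" "j + 2 \<le> k"
  shows "left_of (I v) (I c)"
  using assms
proof (induction j arbitrary: v)
  case (0 v)
  then have [simp]: "v = v\<^sub>0" by (auto dest: distance_layer_0D)
  have c: "c \<in> verts G" using 0 by (auto simp: distance_layer_def)
  \<comment> \<open>An arc raises the distance by at most one, but \<open>k\<close> is at least
    2.\<close>
  have "\<not> v\<^sub>0 \<rightarrow>\<^bsub>G\<^esub> c" using 0 distance_layer_arc_le[of v\<^sub>0 v\<^sub>0 0 c k] by auto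
  moreover have "v\<^sub>0 \<noteq> c" using 0 distance_layer_disjoint[of 0 k G v\<^sub>0] by auto
  ultimately have disj: "I v\<^sub>0 \<inter> I c = {}" using adj_iff v\<^sub>0 c by blast
  obtain x y where xy: "x \<in> I v\<^sub>0" "y \<in> I c" using nonempty v\<^sub>0 c by blast
  have "\<not> y < x"
    using left_of_if_disjoint[of "I c" "I v\<^sub>0" y x] leftmost[OF c] disj xy interval v\<^sub>0 c
    by (auto simp: Int_commute)
  moreover have "x \<noteq> y" using disj xy by auto
  ultimately show ?case
    using left_of_if_disjoint[of "I v\<^sub>0" "I c" x y] disj xy interval v\<^sub>0 c by auto
next
  case (Suc j v)
  then obtain u where u: "u \<in> distance_layer G v\<^sub>0 j" "u \<rightarrow>\<^bsub>G\<^esub> v"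
    by (auto elim: distance_layer_SucE)
  have uc: "left_of (I u) (I c)" using Suc.IH[OF u(1)] Suc.prems by simp
  have vc: "v \<in> verts G" "c \<in> verts G" using Suc.prems by (auto simp: distance_layer_def)
  have "\<not> v \<rightarrow>\<^bsub>G\<^esub> c" using Suc.prems distance_layer_arc_le[of v v\<^sub>0 "Suc j" c k] by auto
  moreover have "v \<noteq> c" using Suc.prems distance_layer_disjoint[of "Suc j" k G v\<^sub>0] by auto
  ultimately have "I v \<inter> I c = {}" using adj_iff vc by blast
  moreover obtain p where "p \<in> I u" "p \<in> I v" using arc_inter[OF u(2)] by auto
  moreover obtain y where "y \<in> I c" using nonempty vc by blast
  \<comment> \<open>The point \<open>p\<close> also lies in \<open>I u\<close>, hence before
    \<open>y\<close>, and this pair fixes the order of \<open>I v\<close> and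
    \<open>I c\<close>.\<close>
  ultimately show ?case
    using left_of_if_disjoint[of "I v" "I c" p y] uc interval vc by (auto simp: left_of_def)
qed

lemma arc_to_next_layer:
  assumes "b \<in> distance_layer G v\<^sub>0 (Suc i)" "c \<in> distance_layer G v\<^sub>0 (Suc (Suc i))"
    and "x \<in> I c" "y \<in> I b" "x \<le> y"
  shows "b \<rightarrow>\<^bsub>G\<^esub> c"
proof -
  obtain w where w: "w \<in> distance_layer G v\<^sub>0 i" "w \<rightarrow>\<^bsub>G\<^esub> b"
    using assms(1) by (rule distance_layer_SucE)
  obtain p where p: "p \<in> I w" "p \<in> I b" using arc_inter[OF w(2)] by auto
  have "left_of (I w) (I c)" using left_of_later_layer[OF w(1) assms(2)] by simp
  \<comment> \<open>So \<open>x\<close> lies between the points \<open>p\<close> and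
    \<open>y\<close> of \<open>I b\<close>.\<close>
  then have "p < x" using p assms by (auto simp: left_of_def)
  moreover have bc: "b \<in> verts G" "c \<in> verts G" using assms by (auto simp: distance_layer_def)
  ultimately have "x \<in> I b"
    using mem_is_interval_1_I[OF interval p(2) assms(4)] assms(5) by simp
  moreover have "b \<noteq> c"
    using assms(1,2) distance_layer_disjoint[of "Suc i" "Suc (Suc i)" G v\<^sub>0] by auto
  ultimately show ?thesis using adj_iff bc assms(3) by blast
qed

lemma multi_chain_ordering_from_leftmost: "multi_chain_ordering_from G v\<^sub>0"
  unfolding multi_chain_ordering_from_def
proof (intro allI impI chain_graph_bipartite_betweenI)
  fix i a b c d
  assume *: "a \<in> distance_layer G v\<^sub>0 i" "b \<in> distance_layer G v\<^sub>0 i"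
    "c \<in> distance_layer G v\<^sub>0 (i + 1)" "d \<in> distance_layer G v\<^sub>0 (i + 1)"
    "a \<noteq> b" "a \<rightarrow>\<^bsub>G\<^esub> c" "b \<rightarrow>\<^bsub>G\<^esub> d"
  show "a \<rightarrow>\<^bsub>G\<^esub> d \<or> b \<rightarrow>\<^bsub>G\<^esub> c"
  proof (cases i)
    case 0
    \<comment> \<open>Layer 0 contains only \<open>v\<^sub>0\<close>, contradicting
      \<open>a \<noteq> b\<close>.\<close>
    then show ?thesis using * by (auto dest: distance_layer_0D)
  next
    case (Suc j)
    obtain x y where "x \<in> I a" "x \<in> I c" "y \<in> I b" "y \<in> I d"
      using arc_inter[OF *(6)] arc_inter[OF *(7)] by auto
    then show ?thesis
      \<comment> \<open>If \<open>y \<le> x\<close>, the two edges exchange roles and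
        \<open>a\<close> is adjacent to \<open>d\<close>.\<close>
      using arc_to_next_layer[of b j c x y] arc_to_next_layer[of a j d y x] * Suc
      by (cases "x \<le> y") auto
  qed
qed (simp_all add: graph_axioms distance_layer_subset_verts distance_layer_disjoint)

end

end

theorem theorem2:
  fixes G :: "('a, 'b) pre_digraph"
  assumes "interval_graph G"
    and "Digraph_Component.connected G"
  shows "has_multi_chain_ordering G"
proof -
  obtain I :: "'a \<Rightarrow> real set" where "graph G"
    and I: "\<forall>v\<in>verts G. is_interval (I v) \<and> I v \<noteq> {}"
    "\<forall>u\<in>verts G. \<forall>v\<in>verts G. u \<noteq> v \<longrightarrow> (u \<rightarrow>\<^bsub>G\<^esub> v \<longleftrightarrow> I u \<inter> I v \<noteq> {})"
    using assms(1) unfolding interval_graph_def by (elim conjE exE) (rule that)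
  interpret interval_representation G I
    by (intro interval_representation.intro interval_representation_axioms.intro \<open>graph G\<close>)
      (simp_all add: I)
  have "verts G \<noteq> {}"
    using assms(2) by (simp add: Digraph_Component.connected_def strongly_connected_def)
  then obtain v\<^sub>0 where v\<^sub>0: "v\<^sub>0 \<in> verts G" "\<And>v. v \<in> verts G \<Longrightarrow> \<not> left_of (I v) (I v\<^sub>0)"
    by (rule ex_leftmost) (rule that)
  then have "multi_chain_ordering_from G v\<^sub>0"
    by (rule multi_chain_ordering_from_leftmost)
  then show ?thesis
    using v\<^sub>0(1) unfolding has_multi_chain_ordering_def by (rule bexI)
qed

end
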